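(* Let $G$ be a topological group. If $G\in[swap]$, then $G\in \mathrm{SIN}$.
   Context: $C(G)$ is the Banach space of bounded continuous real functions on $G$ with the sup norm. A function $f\in C(G)$ is strictly wap ($f\in s\mathrm{WAP}(G)$) if the set $GfG$ of all two-sided translates $x\mapsto f(sxt)$, $s,t\in G$, is relatively weakly compact in $C(G)$. $G\in[swap]$ means that $s\mathrm{WAP}(G)$ separates points and closed subsets of $G$ (it separates the points of $G$, and for every closed $F\subset G$ and $x\notin F$ there is $f\in s\mathrm{WAP}(G)$ with $f(x)\notin\overline{f(F)}$). $G\in\mathrm{SIN}$ (small invariant neighborhoods) means that for every neighborhood $U$ of the identity $e$ there is a neighborhood $O$ of $e$ such that $gOg^{-1}\subset U$ for every $g\in G$. *)

theory Defs
  imports "HOL-Analysis.Analysis"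
begin

text \<open>
  Topological groups are the types of class \<open>topological_group_add\<close>. The class does not assume
  commutativity: the group law is written \<open>+\<close>, the identity \<open>0\<close>, and \<open>g O g\<^sup>-\<^sup>1\<close> reads
  \<open>(\<lambda>x. g + x - g) ` O\<close>. No separation axiom is part of the class. The space \<open>C(G)\<close> is the
  type of bounded continuous functions with its sup norm.
\<close>

definition weak_topology :: "'a::real_normed_vector topology" where
  "weak_topology =
     topology_generated_by {blinfun_apply \<phi> -` U | (\<phi> :: 'a \<Rightarrow>\<^sub>L real) U. open U}"

definition relatively_weakly_compact :: "'a::real_normed_vector set \<Rightarrow> bool" where
  "relatively_weakly_compact S \<longleftrightarrow> compactin weak_topology (weak_topology closure_of S)"

definition two_sided_translate ::
    "'a::topological_group_add \<Rightarrow> 'a \<Rightarrow> ('a \<Rightarrow>\<^sub>C real) \<Rightarrow> ('a \<Rightarrow>\<^sub>C real)" where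
  "two_sided_translate s t f = Bcontfun (\<lambda>x. apply_bcontfun f (s + x + t))"

lemma apply_two_sided_translate [simp]:
  "apply_bcontfun (two_sided_translate s t f) x = apply_bcontfun f (s + x + t)"
proof -
  have "continuous_on UNIV (\<lambda>x. apply_bcontfun f (s + x + t))"
    by (rule continuous_on_compose2[where t = UNIV and g = "apply_bcontfun f"])
      (simp_all add: continuous_on_add continuous_on_const continuous_on_id)
  moreover have "bounded (range (\<lambda>x. apply_bcontfun f (s + x + t)))"
    by (rule bounded_subset[OF bounded_apply_bcontfun[of f]]) auto
  ultimately have "(\<lambda>x. apply_bcontfun f (s + x + t)) \<in> bcontfun"
    by (simp add: bcontfun_def)
  then show ?thesis
    by (simp add: two_sided_translate_def Bcontfun_inverse)
qed

definition sWAP :: "('a::topological_group_add \<Rightarrow>\<^sub>C real) set" where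
  "sWAP = {f. relatively_weakly_compact {two_sided_translate s t f | s t. True}}"

definition separates_points_and_closed_sets :: "('a::topological_space \<Rightarrow>\<^sub>C real) set \<Rightarrow> bool" where
  "separates_points_and_closed_sets A \<longleftrightarrow>
     (\<forall>x y. x \<noteq> y \<longrightarrow> (\<exists>f\<in>A. apply_bcontfun f x \<noteq> apply_bcontfun f y)) \<and>
     (\<forall>F x. closed F \<and> x \<notin> F \<longrightarrow> (\<exists>f\<in>A. apply_bcontfun f x \<notin> closure (apply_bcontfun f ` F)))"

text \<open>\<open>swap\<close> and \<open>SIN\<close> are properties of the group, hence predicates on its type.\<close>

definition swap :: "'a::topological_group_add itself \<Rightarrow> bool" where
  "swap _ \<longleftrightarrow> separates_points_and_closed_sets (sWAP :: ('a \<Rightarrow>\<^sub>C real) set)"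

text \<open>A neighborhood of \<open>0\<close>, not necessarily open, is a set with \<open>0\<close> in its interior.\<close>

definition SIN :: "'a::topological_group_add itself \<Rightarrow> bool" where
  "SIN _ \<longleftrightarrow>
     (\<forall>U :: 'a set. 0 \<in> interior U \<longrightarrow>
        (\<exists>V. 0 \<in> interior V \<and> (\<forall>g. (\<lambda>x. g + x - g) ` V \<subseteq> U)))"

end

theory Submission
  imports Defs
begin

text \<open>
  Let \<open>f\<close> be strictly wap and \<open>K\<close> the weak closure of the set of its two-sided translates. It suffices
  to find a nonempty open \<open>U\<close> on which all these translates oscillate by less than \<open>e\<close>: moving \<open>U\<close> to
  the identity makes the conjugates of \<open>f\<close> equicontinuous there, because every
  \<open>x \<mapsto> f (g x g\<^sup>-\<^sup>1)\<close> is itself a translate of \<open>f\<close>.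

  If there is no such \<open>U\<close>, then every nonempty open set contains two open sets whose points are
  separated by a translate of \<open>f\<close>, which yields a dyadic tree of open sets. Choose a point in each.
  Along each branch the point evaluations cluster at a bounded linear functional, and functionals of
  different branches stay apart on \<open>K\<close>. But on the weakly compact set \<open>K\<close> all of these uncountably many
  functionals are continuous and factor through evaluation at the countably many chosen points, and
  the continuous functions on a compact metrizable space are separable.
\<close>

section \<open>Continuous functions that factor through countably many others on a compact
  set\<close>

text \<open>Compactness of \<open>K \<times> K\<close> turns dependence on all values
  \<open>q n\<close> into uniform dependence on finitely many. A single natural number
  \<open>N\<close> serves as both their number and the tolerance, so only countably many moduli
  occur; the pigeonhole argument in the next lemma relies on this.\<close>

lemma uniformly_determined_on_compact:
  fixes q :: "nat \<Rightarrow> 'a \<Rightarrow> real" and p :: "'a \<Rightarrow> real"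
  assumes K: "compactin X K"
    and q: "\<And>n. continuous_map X euclideanreal (q n)"
    and p: "continuous_map X euclideanreal p"
    and det: "\<And>k k'. \<lbrakk>k \<in> K; k' \<in> K; \<And>n. q n k = q n k'\<rbrakk> \<Longrightarrow> p k = p k'"
    and e: "e > 0"
  shows "\<exists>N. \<forall>k\<in>K. \<forall>k'\<in>K. (\<forall>n<N. \<bar>q n k - q n k'\<bar> < 1 / Suc N) \<longrightarrow> \<bar>p k - p k'\<bar> < e"
proof -
  let ?Y = "prod_topology X X"
  \<comment> \<open>A pair lies in \<open>U n\<close> if \<open>p\<close> nearly agrees on it or one
    of the first \<open>n\<close> functions \<open>q i\<close> tells it apart by more than
    \<open>1 / Suc n\<close>. These open sets increase with \<open>n\<close>, so a finite subcover
    of \<open>K \<times> K\<close> reduces to one of them.\<close>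
  define U where "U n = {z \<in> topspace ?Y. \<bar>p (fst z) - p (snd z)\<bar> < e}
      \<union> (\<Union>i<n. {z \<in> topspace ?Y. \<bar>q i (fst z) - q i (snd z)\<bar> > 1 / Suc n})" for n
  have diff: "continuous_map ?Y euclideanreal (\<lambda>z. \<bar>h (fst z) - h (snd z)\<bar>)"
    if "continuous_map X euclideanreal h" for h
    using continuous_map_compose[OF continuous_map_fst that]
      continuous_map_compose[OF continuous_map_snd that]
    by (intro continuous_map_real_abs continuous_map_diff) (auto simp: o_def)
  have "openin ?Y {z \<in> topspace ?Y. \<bar>p (fst z) - p (snd z)\<bar> \<in> {..<e}}"
    by (rule openin_continuous_map_preimage[OF diff[OF p]]) simp
  moreover have "openin ?Y {z \<in> topspace ?Y. \<bar>q i (fst z) - q i (snd z)\<bar> \<in> {c<..}}" for i c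
    by (rule openin_continuous_map_preimage[OF diff[OF q]]) simp
  ultimately have open_U: "openin ?Y (U n)" for n
    by (auto simp: U_def)
  have mono: "U m \<subseteq> U n" if "m \<le> n" for m n
  proof -
    have "1 / real (Suc n) \<le> 1 / Suc m"
      using that by (simp add: field_simps)
    show ?thesis
    proof (rule subsetI)
      fix z assume "z \<in> U m"
      then show "z \<in> U n"
        using \<open>1 / real (Suc n) \<le> 1 / Suc m\<close> that unfolding U_def
        by (elim UnE UN_E) (auto simp del: of_nat_Suc intro: order_le_less_trans order_less_le_trans)
    qed
  qed
  have "K \<times> K \<subseteq> \<Union> (range U)"
  proof clarify
    fix k k' assume kk: "k \<in> K" "k' \<in> K"
    then have top: "k \<in> topspace X" "k' \<in> topspace X"
      using compactin_subset_topspace[OF K] by auto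
    show "(k, k') \<in> \<Union> (range U)"
    proof (cases "\<forall>n. q n k = q n k'")
      case True
      then show ?thesis
        using det[OF kk] e top by (auto simp: U_def)
    next
      case False
      then obtain i where "\<bar>q i k - q i k'\<bar> > 0"
        by auto
      then obtain m where m: "1 / Suc m < \<bar>q i k - q i k'\<bar>"
        using nat_approx_posE by metis
      \<comment> \<open>Large enough both for \<open>i\<close> to be among the tested indices and
        for the tolerance to fall below the gap at \<open>i\<close>.\<close>
      define n where "n = max m (Suc i)"
      have "1 / real (Suc n) \<le> 1 / Suc m"
        by (simp add: n_def field_simps)
      with m have "1 / Suc n < \<bar>q i k - q i k'\<bar>" by linarith
      moreover have "i < n" by (simp add: n_def)
      ultimately have "(k, k') \<in> U n"
        using top by (auto simp: U_def)
      then show ?thesis by blast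
    qed
  qed
  moreover have "compactin ?Y (K \<times> K)"
    using K by (simp add: compactin_Times)
  ultimately obtain \<F> where F: "finite \<F>" "\<F> \<subseteq> range U" "K \<times> K \<subseteq> \<Union>\<F>"
    using open_U unfolding compactin_def by (metis (no_types, lifting) imageE)
  then obtain I where I: "finite I" "\<F> = U ` I"
    by (meson finite_subset_image)
  obtain N where N: "\<forall>i\<in>I. i \<le> N"
    using I(1) unfolding finite_nat_set_iff_bounded_le ..
  have "K \<times> K \<subseteq> U N"
    using F(3) I(2) N mono by blast
  show ?thesis
  proof (intro exI ballI impI)
    fix k k' assume kk: "k \<in> K" "k' \<in> K" "\<forall>n<N. \<bar>q n k - q n k'\<bar> < 1 / Suc N"
    have "(k, k') \<in> U N"
      using kk(1,2) \<open>K \<times> K \<subseteq> U N\<close> by blast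
    moreover have "\<not> 1 / Suc N < \<bar>q i k - q i k'\<bar>" if "i < N" for i
      using kk(3) that by (meson less_asym)
    ultimately show "\<bar>p k - p k'\<bar> < e"
      by (simp add: U_def del: of_nat_Suc)
  qed
qed

text \<open>This is the separability of the space of continuous functions on the image of \<open>K\<close> in a
  countable power of the real line.\<close>

lemma uncountable_family_not_separated:
  fixes q :: "nat \<Rightarrow> 'a \<Rightarrow> real" and p :: "'b \<Rightarrow> 'a \<Rightarrow> real"
  assumes K: "compactin X K"
    and q: "\<And>n. continuous_map X euclideanreal (q n)"
    and p: "\<And>b. b \<in> B \<Longrightarrow> continuous_map X euclideanreal (p b)"
    and det: "\<And>b k k'. \<lbrakk>b \<in> B; k \<in> K; k' \<in> K; \<And>n. q n k = q n k'\<rbrakk> \<Longrightarrow> p b k = p b k'"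
    and B: "uncountable B"
    and e: "e > 0"
  obtains b c where "b \<in> B" "c \<in> B" "b \<noteq> c" "\<And>k. k \<in> K \<Longrightarrow> \<bar>p b k - p c k\<bar> < e"
proof -
  have e3: "e / 3 > 0" using e by simp
  have "\<forall>b\<in>B. \<exists>N. \<forall>k\<in>K. \<forall>k'\<in>K. (\<forall>n<N. \<bar>q n k - q n k'\<bar> < 1 / Suc N)
      \<longrightarrow> \<bar>p b k - p b k'\<bar> < e / 3"
  proof
    fix b assume "b \<in> B"
    then show "\<exists>N. \<forall>k\<in>K. \<forall>k'\<in>K. (\<forall>n<N. \<bar>q n k - q n k'\<bar> < 1 / Suc N)
        \<longrightarrow> \<bar>p b k - p b k'\<bar> < e / 3"
      by (intro uniformly_determined_on_compact[OF K q p _ e3] det)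
  qed
  then obtain N where N: "\<And>b k k'. \<lbrakk>b \<in> B; k \<in> K; k' \<in> K;
      \<forall>n<N b. \<bar>q n k - q n k'\<bar> < 1 / Suc (N b)\<rbrakk> \<Longrightarrow> \<bar>p b k - p b k'\<bar> < e / 3"
    by metis
  \<comment> \<open>Pigeonhole: uncountably many members of the family share one modulus.\<close>
  obtain M where M: "uncountable {b \<in> B. N b = M}"
  proof -
    have "B = (\<Union>M. {b \<in> B. N b = M})" by auto
    then show ?thesis
      using that B countable_UN[of UNIV "\<lambda>M. {b \<in> B. N b = M}"] by auto
  qed
  \<comment> \<open>The factor \<open>topspace X\<close> matters for \<open>M = 0\<close>, where the
    intersection over \<open>n<M\<close> is \<open>UNIV\<close>.\<close>
  define V where "V r = topspace X \<inter> (\<Inter>n<M. {k \<in> topspace X. \<bar>q n r - q n k\<bar> < 1 / Suc M})" for r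
  have "openin X {k \<in> topspace X. q n k \<in> ball (q n r) (1 / Suc M)}" for n r
    by (rule openin_continuous_map_preimage[OF q]) simp
  then have "openin X {k \<in> topspace X. \<bar>q n r - q n k\<bar> < 1 / Suc M}" for n r
    by (simp add: dist_real_def)
  then have "openin X (V r)" for r
    unfolding V_def by (cases M) (auto intro!: openin_Int openin_INT)
  moreover have "K \<subseteq> \<Union> (V ` K)"
    using compactin_subset_topspace[OF K] by (auto simp: V_def)
  ultimately obtain R where R: "finite R" "R \<subseteq> K" "K \<subseteq> \<Union> (V ` R)"
    using K unfolding compactin_def
    by (smt (verit, ccfv_threshold) finite_subset_image image_iff)
  \<comment> \<open>Rounding the values on the finite net \<open>R\<close> to multiples of
    \<open>e / 3\<close> leaves countably many cells, so two members with modulus \<open>M\<close>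
    share one. They differ by less than \<open>e / 3\<close> on \<open>R\<close>, and moving from
    \<open>k\<close> to a net point costs \<open>e / 3\<close> for each of the two.\<close>
  define cell where "cell b = restrict (\<lambda>r. \<lfloor>3 * p b r / e\<rfloor>) R" for b
  have near: "\<bar>p b r - p c r\<bar> < e / 3" if "cell b = cell c" "r \<in> R" for b c r
  proof -
    have "\<lfloor>3 * p b r / e\<rfloor> = \<lfloor>3 * p c r / e\<rfloor>"
      using fun_cong[OF that(1), of r] that(2) by (simp add: cell_def)
    then have "\<bar>3 * p b r / e - 3 * p c r / e\<bar> < 1" by linarith
    then have "\<bar>(p b r - p c r) * (3 / e)\<bar> < 1" by (simp add: algebra_simps diff_divide_distrib)
    then have "\<bar>p b r - p c r\<bar> * (3 / e) < 1"
      using e by (simp only: abs_mult) simp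
    then show ?thesis
      using e pos_less_divide_eq[of "3 / e" "\<bar>p b r - p c r\<bar>" 1] by simp
  qed
  have "countable (R \<rightarrow>\<^sub>E (UNIV :: int set))"
    using R(1) by (intro countable_PiE) auto
  moreover have "cell ` {b \<in> B. N b = M} \<subseteq> R \<rightarrow>\<^sub>E UNIV"
    by (auto simp: cell_def)
  ultimately have "countable (cell ` {b \<in> B. N b = M})"
    using countable_subset by blast
  then have "\<not> inj_on cell {b \<in> B. N b = M}"
    using M countable_image_inj_on by blast
  then obtain b c where bc: "b \<in> B" "c \<in> B" "N b = M" "N c = M" "b \<noteq> c" "cell b = cell c"
    unfolding inj_on_def by blast
  show thesis
  proof (rule that[OF bc(1,2,5)])
    fix k assume k: "k \<in> K"
    then obtain r where r: "r \<in> R" "k \<in> V r"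
      using R(3) by blast
    then have "\<bar>p b r - p b k\<bar> < e / 3" "\<bar>p c r - p c k\<bar> < e / 3"
      using N[OF bc(1) _ k, of r] N[OF bc(2) _ k, of r] R(2) bc(3,4) by (auto simp: V_def)
    with near[OF bc(6) r(1)] show "\<bar>p b k - p c k\<bar> < e"
      by linarith
  qed
qed

section \<open>Cluster functionals of point evaluations, and the weak topology\<close>

text \<open>Tychonoff: the sequence stays in a compact product of intervals, so the closures of its
  tails have a common point. A finite set \<open>A\<close> of coordinates is what a basic
  neighborhood of that point controls.\<close>

lemma exists_pointwise_cluster_point:
  fixes u :: "nat \<Rightarrow> 'f \<Rightarrow> real"
  assumes bound: "\<And>n f. \<bar>u n f\<bar> \<le> M f"
  shows "\<exists>p. \<forall>A e n. finite A \<longrightarrow> e > 0 \<longrightarrow> (\<exists>m\<ge>n. \<forall>f\<in>A. \<bar>u m f - p f\<bar> < e)"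
proof -
  define S where "S = (\<Pi>\<^sub>E f\<in>UNIV. {- M f..M f})"
  define C where "C n = closure (u ` {n..})" for n
  have "compactin (product_topology (\<lambda>_. euclidean) UNIV) S"
    unfolding S_def by (subst compactin_PiE) auto
  then have S: "compact S"
    by (simp add: euclidean_product_topology)
  have "u n \<in> S" for n
    using bound[of n] by (auto simp: S_def abs_le_iff) (metis minus_le_iff)
  then have "S \<inter> (\<Inter>n\<in>I. C n) \<noteq> {}" if "finite I" for I
  proof -
    obtain m where "\<forall>i\<in>I. i \<le> m"
      using \<open>finite I\<close> unfolding finite_nat_set_iff_bounded_le ..
    then have "u m \<in> C i" if "i \<in> I" for i
      using that closure_subset unfolding C_def by fastforce
    then show ?thesis using \<open>u m \<in> S\<close> by blast
  qed
  then have "S \<inter> (\<Inter>n\<in>UNIV. C n) \<noteq> {}"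
    using compact_imp_fip_image[OF S, of UNIV C] by (simp add: C_def)
  then obtain p where p: "\<And>n. p \<in> C n" by auto
  show ?thesis
  proof (intro exI[of _ p] allI impI)
    fix A :: "'f set" and e :: real and n :: nat
    assume A: "finite A" "e > 0"
    have "open ((\<lambda>v. v f) -` ball (p f) e)" for f
      by (intro open_vimage open_ball continuous_on_product_coordinates)
    then have "open (\<Inter>f\<in>A. (\<lambda>v. v f) -` ball (p f) e)"
      using A by blast
    moreover have "p \<in> (\<Inter>f\<in>A. (\<lambda>v. v f) -` ball (p f) e)"
      using A by simp
    ultimately have "(\<Inter>f\<in>A. (\<lambda>v. v f) -` ball (p f) e) \<inter> u ` {n..} \<noteq> {}"
      using p[of n] open_Int_closure_eq_empty unfolding C_def by blast
    then show "\<exists>m\<ge>n. \<forall>f\<in>A. \<bar>u m f - p f\<bar> < e"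
      by (auto simp: dist_real_def abs_minus_commute)
  qed
qed

lemma topspace_weak_topology [simp]: "topspace (weak_topology :: 'a::real_normed_vector topology) = UNIV"
proof -
  have "UNIV \<in> {blinfun_apply \<phi> -` U | (\<phi> :: 'a \<Rightarrow>\<^sub>L real) U. open U}"
    using open_UNIV by blast
  then show ?thesis
    unfolding weak_topology_def topology_generated_by_topspace by blast
qed

lemma continuous_map_weak_topology:
  assumes "bounded_linear p"
  shows "continuous_map weak_topology euclideanreal p"
proof -
  have "openin weak_topology (p -` U)" if "open U" for U
    unfolding weak_topology_def
    using that bounded_linear_Blinfun_apply[OF assms]
    by (intro topology_generated_by_Basis) (metis (mono_tags, lifting) mem_Collect_eq)
  then show ?thesis
    by (auto simp: continuous_map_def vimage_def)
qed

lemma bounded_linear_apply_bcontfun: "bounded_linear (\<lambda>f. apply_bcontfun f x :: real)"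
  by (rule bounded_linear_intro[where K = 1])
    (simp_all add: plus_bcontfun.rep_eq scaleR_bcontfun.rep_eq norm_bounded flip: real_norm_def)

text \<open>Additivity, homogeneity and the norm bound each involve only finitely many functions at
  a time, so they pass from point evaluations to a pointwise cluster point.\<close>

lemma exists_cluster_functional:
  fixes x :: "nat \<Rightarrow> 'a::topological_space"
  shows "\<exists>p :: ('a \<Rightarrow>\<^sub>C real) \<Rightarrow> real. bounded_linear p \<and>
    (\<forall>A e n. finite A \<longrightarrow> e > 0 \<longrightarrow> (\<exists>m\<ge>n. \<forall>f\<in>A. \<bar>apply_bcontfun f (x m) - p f\<bar> < e))"
proof -
  have "\<bar>apply_bcontfun f (x m)\<bar> \<le> norm f" for f m
    using norm_bounded[of f "x m"] by simp
  from exists_pointwise_cluster_point[of "\<lambda>m f. apply_bcontfun f (x m)", OF this]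
  obtain p :: "('a \<Rightarrow>\<^sub>C real) \<Rightarrow> real" where p': "\<forall>A e n. finite A \<longrightarrow> e > 0 \<longrightarrow>
      (\<exists>m\<ge>n. \<forall>f\<in>A. \<bar>apply_bcontfun f (x m) - p f\<bar> < e)" ..
  note p = this[rule_format]
  have "bounded_linear p"
  proof (rule bounded_linear_intro[where K = 1])
    fix f g
    have "\<bar>p (f + g) - (p f + p g)\<bar> \<le> e" if "e > 0" for e
    proof -
      obtain m where "\<bar>apply_bcontfun f (x m) - p f\<bar> < e / 3"
        "\<bar>apply_bcontfun g (x m) - p g\<bar> < e / 3"
        "\<bar>apply_bcontfun (f + g) (x m) - p (f + g)\<bar> < e / 3"
        using p[of "{f, g, f + g}" "e / 3" 0] \<open>e > 0\<close> by auto
      then show ?thesis unfolding plus_bcontfun.rep_eq by linarith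
    qed
    then show "p (f + g) = p f + p g"
      using field_le_epsilon[of "\<bar>p (f + g) - (p f + p g)\<bar>" 0] by simp
  next
    fix r f
    have "\<bar>p (r *\<^sub>R f) - r * p f\<bar> \<le> e" if "e > 0" for e
    proof -
      define d where "d = e / (1 + \<bar>r\<bar>)"
      have d: "d > 0" "d * (1 + \<bar>r\<bar>) = e" using that by (auto simp: d_def)
      obtain m where m: "\<forall>h\<in>{f, r *\<^sub>R f}. \<bar>apply_bcontfun h (x m) - p h\<bar> < d"
        using p[of "{f, r *\<^sub>R f}" d 0] d(1) by auto
      have "\<bar>r * apply_bcontfun f (x m) - r * p f\<bar> \<le> \<bar>r\<bar> * d"
        using m by (simp flip: right_diff_distrib add: abs_mult mult_left_mono)
      moreover have "\<bar>r * apply_bcontfun f (x m) - p (r *\<^sub>R f)\<bar> < d"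
        using m by (simp add: scaleR_bcontfun.rep_eq)
      moreover have "\<bar>r\<bar> * d + d = e"
        using d(2) by (simp add: algebra_simps)
      ultimately show ?thesis by linarith
    qed
    then show "p (r *\<^sub>R f) = r *\<^sub>R p f"
      using field_le_epsilon[of "\<bar>p (r *\<^sub>R f) - r * p f\<bar>" 0] by simp
  next
    fix f
    have "\<bar>p f\<bar> \<le> norm f + e" if "e > 0" for e
    proof -
      obtain m where "\<bar>apply_bcontfun f (x m) - p f\<bar> < e"
        using p[of "{f}" e 0] \<open>e > 0\<close> by auto
      then show ?thesis using norm_bounded[of f "x m"] by simp
    qed
    then show "norm (p f) \<le> norm f * 1"
      using field_le_epsilon[of "\<bar>p f\<bar>" "norm f"] by simp
  qed
  then show ?thesis using p' by (intro exI conjI)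
qed

section \<open>The dyadic tree of open sets\<close>

lemma sWAP_uniformly_near_on_open:
  fixes f :: "'a::topological_group_add \<Rightarrow>\<^sub>C real"
  assumes f: "f \<in> sWAP" and e: "e > 0"
  shows "\<exists>U. open U \<and> U \<noteq> {} \<and> (\<forall>x\<in>U. \<forall>y\<in>U. \<forall>s t. \<bar>f (s + x + t) - f (s + y + t)\<bar> < e)"
proof (rule ccontr)
  assume contra: "\<not> ?thesis"
  define translates where "translates = {two_sided_translate s t f | s t. True}"
  define K where "K = weak_topology closure_of translates"
  have K: "compactin weak_topology K"
    using f by (simp add: sWAP_def relatively_weakly_compact_def translates_def K_def)
  have "translates \<subseteq> K"
    unfolding K_def by (rule closure_of_subset) simp
  have "\<exists>k A. k \<in> translates \<and> (\<forall>i::bool. open (A i) \<and> A i \<noteq> {} \<and> A i \<subseteq> U) \<and>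
      (\<forall>x\<in>A False. \<forall>y\<in>A True. e / 2 < \<bar>apply_bcontfun k x - apply_bcontfun k y\<bar>)"
    if U: "open U" "U \<noteq> {}" for U
  proof -
    obtain x y s t where xy: "x \<in> U" "y \<in> U" "\<bar>f (s + x + t) - f (s + y + t)\<bar> \<ge> e"
      using contra U by (meson not_le)
    define k where "k = two_sided_translate s t f"
    have k: "\<bar>apply_bcontfun k x - apply_bcontfun k y\<bar> \<ge> e" "k \<in> translates"
      using xy by (auto simp: k_def translates_def)
    \<comment> \<open>The values of \<open>k\<close> at \<open>x\<close> and \<open>y\<close> are at
      least \<open>e\<close> apart; radius \<open>e / 4\<close> on each side leaves a gap of
      \<open>e / 2\<close>.\<close>
    define A where "A i = U \<inter> apply_bcontfun k -` ball (k (if i then y else x)) (e / 4)" for i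
    have "open (A i)" for i
      unfolding A_def using U
      by (intro open_Int open_vimage open_ball) (auto intro: continuous_on_apply_bcontfun)
    moreover have "A i \<noteq> {}" for i
      using xy e by (cases i) (auto simp: A_def intro: exI[of _ x] exI[of _ y])
    moreover have "A i \<subseteq> U" for i
      by (auto simp: A_def)
    moreover have "e / 2 < \<bar>apply_bcontfun k x' - apply_bcontfun k y'\<bar>"
      if "x' \<in> A False" "y' \<in> A True" for x' y'
    proof -
      have "\<bar>apply_bcontfun k x - apply_bcontfun k x'\<bar> < e / 4"
        "\<bar>apply_bcontfun k y - apply_bcontfun k y'\<bar> < e / 4"
        using that by (auto simp: A_def dist_real_def)
      with k(1) show ?thesis by linarith
    qed
    ultimately show ?thesis
      using k(2) by blast
  qed
  then obtain k A where kA: "\<And>U. \<lbrakk>open U; U \<noteq> {}\<rbrakk> \<Longrightarrow> k U \<in> translates \<and>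
      (\<forall>i::bool. open (A U i) \<and> A U i \<noteq> {} \<and> A U i \<subseteq> U) \<and>
      (\<forall>x\<in>A U False. \<forall>y\<in>A U True. e / 2 < \<bar>apply_bcontfun (k U) x - apply_bcontfun (k U) y\<bar>)"
    by metis
  \<comment> \<open>The head of the list is the latest choice, since \<open>foldr\<close> applies it
    last; hence the \<open>rev\<close> in \<open>node\<close> below.\<close>
  define T where "T \<sigma> = foldr (\<lambda>i U. A U i) \<sigma> UNIV" for \<sigma>
  have T_Cons: "T (i # \<sigma>) = A (T \<sigma>) i" for i \<sigma>
    by (simp add: T_def)
  have T: "open (T \<sigma>) \<and> T \<sigma> \<noteq> {}" for \<sigma>
    by (induction \<sigma>) (use kA T_Cons in \<open>auto simp: T_def\<close>)
  then have "\<forall>\<sigma>. \<exists>z. z \<in> T \<sigma>"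
    by blast
  then obtain x where x: "\<And>\<sigma>. x \<sigma> \<in> T \<sigma>"
    by metis
  define node where "node b n = rev (map b [0..<n])" for b :: "nat \<Rightarrow> bool" and n
  have node_Suc: "node b (Suc n) = b n # node b n" for b n
    by (simp add: node_def)
  have T_mono: "T (node b m) \<subseteq> T (node b n)" if "n \<le> m" for b n m
    using that
  proof (induction rule: dec_induct)
    case (step m)
    then show ?case
      using kA T[of "node b m"] by (fastforce simp: node_Suc T_Cons)
  qed simp
  have "\<forall>b. \<exists>p :: ('a \<Rightarrow>\<^sub>C real) \<Rightarrow> real. bounded_linear p \<and> (\<forall>F d n. finite F \<longrightarrow> d > 0 \<longrightarrow>
      (\<exists>m\<ge>n. \<forall>h\<in>F. \<bar>apply_bcontfun h (x (node b m)) - p h\<bar> < d))"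
    by (intro allI exists_cluster_functional)
  then obtain p :: "(nat \<Rightarrow> bool) \<Rightarrow> ('a \<Rightarrow>\<^sub>C real) \<Rightarrow> real"
    where p_lin: "\<And>b. bounded_linear (p b)"
    and p: "\<And>b F d n. \<lbrakk>finite F; d > 0\<rbrakk> \<Longrightarrow>
      \<exists>m\<ge>n. \<forall>h\<in>F. \<bar>apply_bcontfun h (x (node b m)) - p b h\<bar> < d"
    by metis
  \<comment> \<open>Lists of booleans are countable, so \<open>from_nat\<close> runs through all
    nodes of the tree.\<close>
  define q where "q n h = apply_bcontfun h (x (from_nat n))" for n and h :: "'a \<Rightarrow>\<^sub>C real"
  have det: "p b h = p b h'" if "\<And>n. q n h = q n h'" for b h h'
  proof -
    have eq: "apply_bcontfun h (x \<sigma>) = apply_bcontfun h' (x \<sigma>)" for \<sigma>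
      using that[of "to_nat \<sigma>"] by (simp add: q_def)
    have "\<bar>p b h - p b h'\<bar> \<le> d" if "d > 0" for d
    proof -
      obtain m where "\<bar>apply_bcontfun h (x (node b m)) - p b h\<bar> < d / 2"
        "\<bar>apply_bcontfun h' (x (node b m)) - p b h'\<bar> < d / 2"
        using p[of "{h, h'}" "d / 2" 0 b] \<open>d > 0\<close> by auto
      then show ?thesis using eq[of "node b m"] by linarith
    qed
    then show ?thesis
      using field_le_epsilon[of "\<bar>p b h - p b h'\<bar>" 0] by simp
  qed
  \<comment> \<open>Cantor's diagonal argument.\<close>
  have unc: "uncountable (UNIV :: (nat \<Rightarrow> bool) set)"
  proof
    assume "countable (UNIV :: (nat \<Rightarrow> bool) set)"
    then obtain g :: "nat \<Rightarrow> nat \<Rightarrow> bool" where "range g = UNIV"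
      using uncountable_def by blast
    then obtain n where "g n = (\<lambda>i. \<not> g i i)"
      by (metis UNIV_I imageE)
    then show False by metis
  qed
  have q_cont: "continuous_map weak_topology euclideanreal (q n)" for n
    unfolding q_def by (intro continuous_map_weak_topology bounded_linear_apply_bcontfun)
  obtain b c where "b \<noteq> c" and near: "\<And>h. h \<in> K \<Longrightarrow> \<bar>p b h - p c h\<bar> < e / 4"
  proof (rule uncountable_family_not_separated[where p = p and q = q and e = "e / 4", OF K q_cont])
    show "continuous_map weak_topology euclideanreal (p b)" for b
      by (rule continuous_map_weak_topology[OF p_lin])
    show "p b h = p b h'" if "\<And>n. q n h = q n h'" for b h h'
      using det that .
    show "uncountable (UNIV :: (nat \<Rightarrow> bool) set)" by (rule unc)
    show "e / 4 > 0" using e by simp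
  qed blast
  \<comment> \<open>The branches \<open>b\<close> and \<open>c\<close> split at their last common
    node \<open>node b n\<close>; the translate attached to it separates its two children.\<close>
  define n where "n = (LEAST i. b i \<noteq> c i)"
  obtain i0 where "b i0 \<noteq> c i0"
    using \<open>b \<noteq> c\<close> by blast
  then have "b n \<noteq> c n"
    unfolding n_def by (rule LeastI)
  have b_eq_c: "b i = c i" if "i < n" for i
    using not_less_Least that unfolding n_def by blast
  have node_eq: "node b n = node c n"
    using b_eq_c by (simp add: node_def)
  define h where "h = k (T (node b n))"
  have "h \<in> K"
    using kA T \<open>translates \<subseteq> K\<close> by (auto simp: h_def)
  \<comment> \<open>From \<open>Suc n\<close> on, the chosen points of the two branches lie in
    different children, where \<open>h\<close> differs by more than \<open>e / 2\<close>. The errors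
    \<open>e / 8\<close>, \<open>e / 8\<close> and \<open>e / 4\<close> add up to exactly
    \<open>e / 2\<close>, a contradiction.\<close>
  obtain i where i: "i \<ge> Suc n" "\<bar>apply_bcontfun h (x (node b i)) - p b h\<bar> < e / 8"
    using p[of "{h}" "e / 8" "Suc n" b] e by auto
  obtain j where j: "j \<ge> Suc n" "\<bar>apply_bcontfun h (x (node c j)) - p c h\<bar> < e / 8"
    using p[of "{h}" "e / 8" "Suc n" c] e by auto
  have sep: "e / 2 < \<bar>apply_bcontfun h y - apply_bcontfun h z\<bar>"
    if "y \<in> A (T (node b n)) False" "z \<in> A (T (node b n)) True" for y z
    using kA[of "T (node b n)"] T[of "node b n"] that unfolding h_def by simp
  have "x (node b i) \<in> A (T (node b n)) (b n)" "x (node c j) \<in> A (T (node b n)) (c n)"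
    using x T_mono[OF i(1), of b] T_mono[OF j(1), of c] by (auto simp: node_Suc T_Cons node_eq)
  then have "e / 2 < \<bar>apply_bcontfun h (x (node b i)) - apply_bcontfun h (x (node c j))\<bar>"
    using \<open>b n \<noteq> c n\<close> sep[of "x (node b i)" "x (node c j)"] sep[of "x (node c j)" "x (node b i)"]
    by (cases "b n"; cases "c n") (simp_all add: abs_minus_commute)
  with i(2) j(2) near[OF \<open>h \<in> K\<close>] show False by linarith
qed

section \<open>Conjugation and invariant neighborhoods\<close>

lemma sWAP_conjugation_equicontinuous:
  fixes f :: "'a::topological_group_add \<Rightarrow>\<^sub>C real"
  assumes "f \<in> sWAP" "e > 0"
  obtains V where "open V" "0 \<in> V" "\<And>g v. v \<in> V \<Longrightarrow> \<bar>f (g + v - g) - f 0\<bar> < e"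
proof -
  obtain U u where U: "open U" "u \<in> U"
    "\<And>x y s t. \<lbrakk>x \<in> U; y \<in> U\<rbrakk> \<Longrightarrow> \<bar>f (s + x + t) - f (s + y + t)\<bar> < e"
    using sWAP_uniformly_near_on_open[OF assms] by blast
  show thesis
  proof
    show "open ((\<lambda>v. u + v) -` U)"
      using U(1) by (intro open_vimage continuous_intros)
    show "0 \<in> (\<lambda>v. u + v) -` U"
      using U(2) by simp
    fix g v assume "v \<in> (\<lambda>v. u + v) -` U"
    \<comment> \<open>With \<open>s = g - u\<close> and \<open>t = - g\<close>, the point
      \<open>u + v\<close> goes to \<open>g + v - g\<close> and \<open>u\<close> goes to
      \<open>0\<close>.\<close>
    then have "\<bar>f ((g - u) + (u + v) + - g) - f ((g - u) + u + - g)\<bar> < e"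
      using U by blast
    moreover have "(g - u) + (u + v) + - g = g + v - g"
      by (simp add: diff_conv_add_uminus add.assoc del: add_uminus_conv_diff)
    ultimately show "\<bar>f (g + v - g) - f 0\<bar> < e"
      by simp
  qed
qed

theorem proposition6p15:
  assumes "swap TYPE('a::topological_group_add)"
  shows "SIN TYPE('a)"
  unfolding SIN_def
proof (intro allI impI)
  fix U :: "'a set"
  assume "0 \<in> interior U"
  \<comment> \<open>Separating \<open>0\<close> from the complement of \<open>interior U\<close>
    makes closeness of \<open>f x\<close> to \<open>f 0\<close> force \<open>x\<close> into
    \<open>U\<close>.\<close>
  then obtain f :: "'a \<Rightarrow>\<^sub>C real" where f: "f \<in> sWAP"
      "f 0 \<notin> closure (apply_bcontfun f ` (- interior U))"
    using assms unfolding swap_def separates_points_and_closed_sets_def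
    by (metis ComplD closed_Compl open_interior)
  then obtain e where e: "e > 0" "\<And>x. x \<notin> interior U \<Longrightarrow> \<bar>f x - f 0\<bar> \<ge> e"
    unfolding closure_approachable by (auto simp: dist_real_def not_less)
  obtain V where V: "open V" "0 \<in> V" "\<And>g v. v \<in> V \<Longrightarrow> \<bar>f (g + v - g) - f 0\<bar> < e"
    using sWAP_conjugation_equicontinuous[OF f(1) e(1)] by blast
  have "g + v - g \<in> U" if "v \<in> V" for g v
    using V(3)[OF that, of g] e(2) interior_subset by (meson not_le subsetD)
  then show "\<exists>V. 0 \<in> interior V \<and> (\<forall>g. (\<lambda>x. g + x - g) ` V \<subseteq> U)"
    using V(1,2) by (intro exI[of _ V]) (auto simp: interior_open)
qed

end
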